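(* Let $\omega\in(0,1)$ be irrational and let $S\colon\mathbb{T}^1\to\mathrm{GL}(d,\mathbb{R})$ be continuous, $d\ge1$. If the induced cocycle $$\mathscr{S}_\omega(n,w)=S(R_\omega^{n-1}(w))\cdots S(R_\omega(w))S(w),\qquad n\in\mathbb{N},\ w\in\mathbb{T}^1,$$ is robustly periodically stable, then it is uniformly exponentially stable, i.e. there are $C>0$ and $0<\gamma<1$ with $\|\mathscr{S}_\omega(n,w)\|\le C\gamma^n$ for all $n\ge1$ and $w\in\mathbb{T}^1$.
   Context: $\mathbb{T}^1$ is the unit circle in $\mathbb{C}$, and $R_x(w)=we^{2\pi \mathrm{i}x}$ for $x\in\mathbb{R}$, $w\in\mathbb{T}^1$. $\|\cdot\|$ is the matrix norm induced by a fixed vector norm on $\mathbb{R}^d$; for matrix-valued maps on $\mathbb{T}^1$, $\|S-B\|=\sup_{w\in\mathbb{T}^1}\|S(w)-B(w)\|$. $\rho$ is the spectral radius. $\mathscr{S}_\omega$ is called robustly periodically stable if there exist $\varepsilon>0$, a sequence of integer pairs $(p_n,q_n)\in\mathbb{N}\times\mathbb{N}$ with $p_n/q_n$ irreducible, $q_n\uparrow+\infty$ and $|\omega-p_n/q_n|<1/q_n^2$ for all $n$, and $N\ge1$, such that for every continuous $B\colon\mathbb{T}^1\to\mathrm{GL}(d,\mathbb{R})$ with $\|S-B\|<\varepsilon$ and every $n\ge N$, writing $x_n=p_n/q_n$, $$\rho\big(B(R_{x_n}^{q_n-1}(w))\cdots B(R_{x_n}(w))B(w)\big)<1\quad\text{for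 all } w\in\mathbb{T}^1.$$ *)

theory Defs
  imports "HOL-Analysis.Analysis"
begin

abbreviation unit_circle :: "complex set" where
  "unit_circle \<equiv> sphere 0 1"

definition rot :: "real \<Rightarrow> complex \<Rightarrow> complex" where
  "rot x w = w * exp (2 * of_real pi * \<i> * of_real x)"

definition is_vector_norm :: "(real ^ 'd \<Rightarrow> real) \<Rightarrow> bool" where
  "is_vector_norm \<nu> \<longleftrightarrow>
     (\<forall>v. 0 \<le> \<nu> v) \<and>
     (\<forall>v. \<nu> v = 0 \<longleftrightarrow> v = 0) \<and>
     (\<forall>c v. \<nu> (c *\<^sub>R v) = \<bar>c\<bar> * \<nu> v) \<and>
     (\<forall>u v. \<nu> (u + v) \<le> \<nu> u + \<nu> v)"

definition induced_norm :: "(real ^ 'd \<Rightarrow> real) \<Rightarrow> real ^ 'd ^ 'd \<Rightarrow> real" where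
  "induced_norm \<nu> A = (SUP v \<in> {v. \<nu> v = 1}. \<nu> (A *v v))"

(* The real-valued supremum is meaningful for F bounded on the circle; it is only used for
   differences of continuous maps. *)
definition map_norm :: "(real ^ 'd \<Rightarrow> real) \<Rightarrow> (complex \<Rightarrow> real ^ 'd ^ 'd) \<Rightarrow> real" where
  "map_norm \<nu> F = (SUP w \<in> unit_circle. induced_norm \<nu> (F w))"

(* Eigenvalues are taken over the complex numbers. *)
definition complex_spectrum :: "real ^ 'd ^ 'd \<Rightarrow> complex set" where
  "complex_spectrum A =
     {\<mu>. \<exists>v :: complex ^ 'd. v \<noteq> 0 \<and> map_matrix of_real A *v v = \<mu> *s v}"

definition matrix_spectral_radius :: "real ^ 'd ^ 'd \<Rightarrow> real" where
  "matrix_spectral_radius A = Max (norm ` complex_spectrum A)"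

(* Maps on the circle are total functions on the complex plane, of which only the values on
   the circle matter. *)
definition continuous_GL_map :: "(complex \<Rightarrow> real ^ 'd ^ 'd) \<Rightarrow> bool" where
  "continuous_GL_map F \<longleftrightarrow>
     continuous_on unit_circle F \<and> (\<forall>w \<in> unit_circle. invertible (F w))"

primrec cocycle :: "(complex \<Rightarrow> real ^ 'd ^ 'd) \<Rightarrow> real \<Rightarrow> nat \<Rightarrow> complex \<Rightarrow> real ^ 'd ^ 'd" where
  "cocycle F x 0 w = mat 1"
| "cocycle F x (Suc n) w = F ((rot x ^^ n) w) ** cocycle F x n w"

definition robustly_periodically_stable ::
  "(real ^ 'd \<Rightarrow> real) \<Rightarrow> (complex \<Rightarrow> real ^ 'd ^ 'd) \<Rightarrow> real \<Rightarrow> bool" where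
  "robustly_periodically_stable \<nu> S \<omega> \<longleftrightarrow>
     (\<exists>\<epsilon> > 0. \<exists>(p :: nat \<Rightarrow> nat) (q :: nat \<Rightarrow> nat).
        (\<forall>n. q n > 0 \<and> coprime (p n) (q n)) \<and>
        incseq q \<and> filterlim q at_top sequentially \<and>
        (\<forall>n. \<bar>\<omega> - real (p n) / real (q n)\<bar> < 1 / (real (q n))\<^sup>2) \<and>
        (\<exists>N \<ge> 1. \<forall>B. continuous_GL_map B \<and> map_norm \<nu> (\<lambda>w. S w - B w) < \<epsilon> \<longrightarrow>
           (\<forall>n \<ge> N. \<forall>w \<in> unit_circle.
              matrix_spectral_radius (cocycle B (real (p n) / real (q n)) (q n) w) < 1)))"

definition uniformly_exponentially_stable ::
  "(real ^ 'd \<Rightarrow> real) \<Rightarrow> (complex \<Rightarrow> real ^ 'd ^ 'd) \<Rightarrow> real \<Rightarrow> bool" where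
  "uniformly_exponentially_stable \<nu> S \<omega> \<longleftrightarrow>
     (\<exists>C > 0. \<exists>\<gamma>. 0 < \<gamma> \<and> \<gamma> < 1 \<and>
        (\<forall>n \<ge> 1. \<forall>w \<in> unit_circle. induced_norm \<nu> (cocycle S \<omega> n w) \<le> C * \<gamma> ^ n))"

end

theory Submission
  imports Defs "HOL-Computational_Algebra.Fundamental_Theorem_Algebra"
begin

text \<open>The robustness hypothesis is used at a single large time \<open>q = q\<^sub>n\<close>. By perturbing \<open>S\<close> along the
  periodic orbit of \<open>w\<close> under the rotation by \<open>p\<^sub>n / q\<^sub>n\<close>, the matrix
  \<open>(I + \<eta> e\<^sub>i e\<^sub>j\<^sup>T) (1 + \<theta>)\<^sup>q \<S>\<^sub>\<omega>(q, w)\<close> becomes the period map of an admissible \<open>B\<close>, for a fixed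
  \<open>\<theta> > 0\<close>, both choices \<open>\<eta> \<in> {0, \<theta>}\<close> and all \<open>i, j\<close>. Its spectral radius is less than 1, so its trace
  is at most \<open>d\<close> in modulus. Comparing the two values of \<open>\<eta>\<close> bounds every entry of
  \<open>(1 + \<theta>)\<^sup>q \<S>\<^sub>\<omega>(q, w)\<close> by \<open>2 d / \<theta>\<close>, uniformly in \<open>w\<close>. For large \<open>q\<close> the cocycle therefore contracts
  uniformly at time \<open>q\<close>, and submultiplicativity gives exponential decay.\<close>

section \<open>Trace bound from the spectral radius\<close>

text \<open>Normalization at 0 makes \<open>p\<close> the product of the factors 1 - z/r over its
  roots r, so its derivative at 0 is minus the sum of the 1/r, each of modulus at most 1. The
  induction strips off one root at a time.\<close>

lemma norm_pderiv_at_0_le_degree: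
  fixes p :: "complex poly"
  assumes "poly p 0 = 1" and "\<And>z. poly p z = 0 \<Longrightarrow> 1 \<le> norm z"
  shows "norm (poly (pderiv p) 0) \<le> degree p"
  using assms
proof (induction "degree p" arbitrary: p)
  case 0
  then obtain c where "p = [:c:]" by (metis degree_eq_zeroE)
  then show ?case by simp
next
  case (Suc n)
  then have "\<not> constant (poly p)" by (simp add: constant_degree)
  then obtain r where r: "poly p r = 0"
    using fundamental_theorem_of_algebra by blast
  have r1: "1 \<le> norm r" using Suc.prems(2) r by blast
  then have r0: "r \<noteq> 0" by auto
  obtain q where q: "p = [:-r, 1:] * q" using r poly_eq_0_iff_dvd by (metis dvdE)
  \<comment> \<open>Moving the factor -r from the linear term into the cofactor turns z - r into 1 -
    z/r, so \<open>s\<close> is again 1 at 0 and the induction hypothesis applies to it.\<close>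
  define s where "s = smult (-r) q"
  have p: "p = [:1, -inverse r:] * s"
    using r0 by (simp add: q s_def smult_add_right)
  have s0: "poly s 0 = 1" using Suc.prems(1) by (simp add: p)
  then have "s \<noteq> 0" by auto
  then have "degree p = Suc (degree s)" using r0 by (simp add: p degree_mult_eq del: mult_pCons_left)
  then have deg: "n = degree s" using Suc.hyps(2) by simp
  have "norm (poly (pderiv s) 0) \<le> degree s"
    using Suc.hyps(1)[OF deg s0] Suc.prems(2) by (simp add: p del: mult_pCons_left)
  moreover have "poly (pderiv p) 0 = poly (pderiv s) 0 - inverse r"
    by (simp add: p pderiv_mult s0 pderiv_pCons del: mult_pCons_left)
  moreover have "norm (inverse r) \<le> 1"
    using r1 by (simp add: norm_inverse inverse_le_1_iff)
  ultimately have "norm (poly (pderiv p) 0) \<le> degree s + 1"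
    using norm_triangle_ineq4[of "poly (pderiv s) 0" "inverse r"] by simp
  then show ?case using \<open>degree p = Suc (degree s)\<close> by simp
qed

text \<open>This is det(I - zA), with matrix entries written as linear polynomials in z. Unlike the
  characteristic polynomial it is 1 at 0, its roots are the inverses of the nonzero eigenvalues, and
  the trace is minus its linear coefficient.\<close>

definition reciprocal_charpoly :: "'a::comm_ring_1 ^ 'n ^ 'n \<Rightarrow> 'a poly" where
  "reciprocal_charpoly A = det (\<chi> i j. [:mat 1 $ i $ j, - A $ i $ j:])"

lemma poly_reciprocal_charpoly:
  "poly (reciprocal_charpoly A) z = det (\<chi> i j. mat 1 $ i $ j - z * A $ i $ j)"
  by (simp add: reciprocal_charpoly_def det_def poly_sum poly_prod)

lemma poly_reciprocal_charpoly_0: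
  fixes A :: "'a::comm_ring_1 ^ 'n ^ 'n"
  shows "poly (reciprocal_charpoly A) 0 = 1"
proof -
  have "(\<chi> i j. mat 1 $ i $ j - 0 * A $ i $ j) = (mat 1 :: 'a ^ 'n ^ 'n)"
    by (simp add: vec_eq_iff)
  then show ?thesis by (simp add: poly_reciprocal_charpoly)
qed

lemma degree_reciprocal_charpoly_le:
  fixes A :: "'a::comm_ring_1 ^ 'n ^ 'n"
  shows "degree (reciprocal_charpoly A) \<le> CARD('n)"
  unfolding reciprocal_charpoly_def det_def
proof (rule degree_sum_le)
  fix p :: "'n \<Rightarrow> 'n"
  let ?f = "\<lambda>i. (\<chi> i j. [:mat 1 $ i $ j, - A $ i $ j:]) $ i $ p i"
  have "degree (of_int (sign p) * prod ?f UNIV)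
      \<le> degree (of_int (sign p) :: 'a poly) + degree (prod ?f UNIV)"
    by (rule degree_mult_le)
  also have "\<dots> \<le> (\<Sum>i\<in>UNIV. degree (?f i))"
    using degree_prod_sum_le[of UNIV ?f] by (simp add: o_def)
  also have "\<dots> \<le> (\<Sum>i\<in>(UNIV :: 'n set). 1)"
    by (intro sum_mono) simp
  finally show "degree (of_int (sign p) * prod ?f UNIV) \<le> CARD('n)" by simp
qed simp

text \<open>Only the identity contributes, since a nontrivial permutation moves at least two points.\<close>

lemma pderiv_reciprocal_charpoly_0:
  fixes A :: "'a::{comm_ring_1,semiring_no_zero_divisors} ^ 'n ^ 'n"
  shows "poly (pderiv (reciprocal_charpoly A)) 0 = - trace A"
proof -
  \<comment> \<open>By the product rule, \<open>g p\<close> is the derivative at 0 of the Leibniz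
    product for \<open>p\<close>: the factor at \<open>a\<close> is differentiated to an entry of
    -A, the others are evaluated at 0.\<close>
  define g where "g p = (\<Sum>a\<in>UNIV. - (A $ a $ p a * (\<Prod>i\<in>UNIV - {a}. mat 1 $ i $ p i)))"
    for p :: "'n \<Rightarrow> 'n"
  have "poly (pderiv (reciprocal_charpoly A)) 0 = (\<Sum>p | p permutes UNIV. of_int (sign p) * g p)"
    by (simp add: reciprocal_charpoly_def det_def higher_pderiv_sum[of 1, simplified] pderiv_mult
        of_int_poly pderiv_smult pderiv_prod poly_sum
        poly_prod pderiv_pCons g_def)
  also have "\<dots> = (\<Sum>p\<in>{id}. of_int (sign p) * g p)"
  proof (rule sum.mono_neutral_right)
    show "\<forall>p\<in>{p. p permutes UNIV} - {id}. of_int (sign p) * g p = 0"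
    proof
      fix p :: "'n \<Rightarrow> 'n"
      assume "p \<in> {p. p permutes UNIV} - {id}"
      then have inj: "inj p" and "p \<noteq> id" by (auto simp: permutes_inj)
      then obtain b where b: "p b \<noteq> b" by (auto simp: fun_eq_iff)
      have "(\<Prod>i\<in>UNIV - {a}. (mat 1 :: 'a ^ 'n ^ 'n) $ i $ p i) = 0" for a
      proof -
        obtain i where "i \<noteq> a" "p i \<noteq> i"
          using b injD[OF inj, of "p b" b] by metis
        then show ?thesis
          by (intro prod_zero bexI[of _ i]) (auto simp: mat_def)
      qed
      then show "of_int (sign p) * g p = 0" by (simp add: g_def)
    qed
  qed (auto simp: permutes_id)
  also have "\<dots> = - trace A"
    by (simp add: g_def trace_def mat_def sum_negf sign_id)
  finally show ?thesis .
qed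

lemma eigenvector_iff_det_eq_0:
  fixes A :: "'a::field ^ 'n ^ 'n"
  shows "(\<exists>v. v \<noteq> 0 \<and> A *v v = 0) \<longleftrightarrow> det A = 0"
proof -
  have "det A \<noteq> 0 \<longleftrightarrow> (\<forall>v. A *v v = 0 \<longrightarrow> v = 0)"
    unfolding invertible_det_nz[symmetric] invertible_left_inverse matrix_left_invertible_ker ..
  then show ?thesis by blast
qed

text \<open>A root z is a point where I - zA has a nontrivial kernel. At z = 0 both sides fail, so
  no case distinction arises.\<close>

lemma reciprocal_charpoly_root_iff:
  fixes A :: "'a::field ^ 'n ^ 'n"
  shows "poly (reciprocal_charpoly A) z = 0 \<longleftrightarrow> (\<exists>v. v \<noteq> 0 \<and> z *s (A *v v) = v)"
proof -
  have "(\<chi> i j. mat 1 $ i $ j - z * A $ i $ j) *v v = v - z *s (A *v v)" for v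
    by (simp add: vec_eq_iff matrix_vector_mult_def mat_def left_diff_distrib sum_subtractf
        sum_distrib_left mult.assoc if_distrib[of "\<lambda>x. x * _"] cong: if_cong)
  then show ?thesis
    unfolding poly_reciprocal_charpoly eigenvector_iff_det_eq_0[symmetric]
    by (auto simp: eq_commute[of _ "z *s _"])
qed

lemma complex_spectrum_nonzero_iff:
  assumes "\<mu> \<noteq> 0"
  shows "\<mu> \<in> complex_spectrum A
    \<longleftrightarrow> poly (reciprocal_charpoly (map_matrix of_real A)) (inverse \<mu>) = 0"
proof -
  have "inverse \<mu> *s u = v \<longleftrightarrow> u = \<mu> *s v" for u v :: "complex ^ 'a"
    unfolding vec_eq_iff using assms
    by (intro iff_allI) (simp add: field_simps)
  then show ?thesis by (simp add: complex_spectrum_def reciprocal_charpoly_root_iff)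
qed

text \<open>Nonzero eigenvalues are inverses of roots of a nonzero polynomial. Finiteness is what
  makes the \<open>Max\<close> in \<open>matrix_spectral_radius\<close> an upper bound for all
  eigenvalue moduli.\<close>

lemma finite_complex_spectrum: "finite (complex_spectrum A)"
proof -
  let ?R = "{z. poly (reciprocal_charpoly (map_matrix complex_of_real A)) z = 0}"
  have "reciprocal_charpoly (map_matrix complex_of_real A) \<noteq> 0"
    using poly_reciprocal_charpoly_0 by (metis poly_0 zero_neq_one)
  then have "finite (insert 0 (inverse ` ?R))" by (simp add: poly_roots_finite)
  moreover have "complex_spectrum A \<subseteq> insert 0 (inverse ` ?R)"
  proof
    fix \<mu> assume "\<mu> \<in> complex_spectrum A"
    then have "\<mu> \<noteq> 0 \<Longrightarrow> inverse \<mu> \<in> ?R" using complex_spectrum_nonzero_iff[of \<mu> A] by simp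
    then have "\<mu> \<noteq> 0 \<Longrightarrow> inverse (inverse \<mu>) \<in> inverse ` ?R" by (rule imageI)
    then show "\<mu> \<in> insert 0 (inverse ` ?R)"
      by (cases "\<mu> = 0") (simp_all only: insertI1 insertI2 inverse_inverse_eq not_False_eq_True simp_thms)
  qed
  ultimately show ?thesis by (rule rev_finite_subset)
qed

text \<open>The roots of det(I - zA) have modulus above 1, so the derivative bound at 0 applies to
  it. This avoids counting eigenvalues with multiplicity.\<close>

lemma abs_trace_le_of_spectral_radius_less_1:
  fixes A :: "real ^ 'd ^ 'd"
  assumes "matrix_spectral_radius A < 1"
  shows "\<bar>trace A\<bar> \<le> CARD('d)"
proof -
  let ?A = "map_matrix complex_of_real A"
  have "1 \<le> norm z" if z: "poly (reciprocal_charpoly ?A) z = 0" for z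
  proof -
    have "z \<noteq> 0" using z poly_reciprocal_charpoly_0[of ?A] by auto
    then have "inverse z \<in> complex_spectrum A"
      using z complex_spectrum_nonzero_iff[of "inverse z" A] by simp
    then have "norm (inverse z) \<le> matrix_spectral_radius A"
      unfolding matrix_spectral_radius_def by (intro Max_ge) (auto simp: finite_complex_spectrum)
    then have "inverse (norm z) < 1" using assms by (simp add: norm_inverse)
    then show ?thesis using \<open>z \<noteq> 0\<close> by (simp add: inverse_less_1_iff)
  qed
  then have "norm (trace ?A) \<le> degree (reciprocal_charpoly ?A)"
    using norm_pderiv_at_0_le_degree[of "reciprocal_charpoly ?A"]
    by (simp add: poly_reciprocal_charpoly_0 pderiv_reciprocal_charpoly_0)
  moreover have "trace ?A = of_real (trace A)" by (simp add: trace_def)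
  ultimately show ?thesis
    using degree_reciprocal_charpoly_le[of ?A] by (simp del: of_nat_le_iff add: le_trans)
qed

section \<open>Row operations and entry bounds\<close>

text \<open>Elementary row operation: left multiplication by \<open>I + \<eta> e\<^sub>i e\<^sub>j\<^sup>T\<close>.\<close>

definition add_row_multiple :: "real \<Rightarrow> 'm \<Rightarrow> 'm \<Rightarrow> real ^ 'n ^ 'm \<Rightarrow> real ^ 'n ^ 'm" where
  "add_row_multiple \<eta> i j A = A + \<eta> *\<^sub>R axis i (A $ j)"

lemma add_row_multiple_mult:
  "add_row_multiple \<eta> i j A ** C = add_row_multiple \<eta> i j (A ** C)"
  by (simp add: vec_eq_iff add_row_multiple_def matrix_matrix_mult_def axis_def
      distrib_right sum.distrib sum_distrib_left mult.assoc)

lemma add_row_multiple_scaleR: "add_row_multiple \<eta> i j (c *\<^sub>R A) = c *\<^sub>R add_row_multiple \<eta> i j A"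
  by (simp add: vec_eq_iff add_row_multiple_def axis_def algebra_simps)

lemma trace_add_row_multiple: "trace (add_row_multiple \<eta> i j A) = trace A + \<eta> * A $ j $ i"
  by (simp add: trace_def add_row_multiple_def axis_def sum.distrib sum_distrib_left[symmetric]
      if_distrib[of "\<lambda>x. x $ _"] cong: if_cong)

lemma norm_axis: "norm (axis i x) = norm x"
proof -
  have "(norm (axis i x $ k))\<^sup>2 = (if k = i then (norm x)\<^sup>2 else 0)" for k
    by (simp add: axis_def)
  then show ?thesis by (simp add: norm_vec_def L2_set_def)
qed

text \<open>Scaling contributes \<theta>, and the added row at most \<eta>(1 + \<theta>) \<le>
  2\<theta>, each relative to the norm of \<open>A\<close>.\<close>

lemma norm_add_row_multiple_diff_le:
  fixes A :: "real ^ 'n ^ 'm"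
  assumes "0 \<le> \<theta>" "\<theta> \<le> 1" "0 \<le> \<eta>" "\<eta> \<le> \<theta>"
  shows "norm (add_row_multiple \<eta> i j ((1 + \<theta>) *\<^sub>R A) - A) \<le> 3 * \<theta> * norm A"
proof -
  have "add_row_multiple \<eta> i j ((1 + \<theta>) *\<^sub>R A) - A
      = \<theta> *\<^sub>R A + (\<eta> * (1 + \<theta>)) *\<^sub>R axis i (A $ j)"
    by (simp add: vec_eq_iff add_row_multiple_def axis_def algebra_simps)
  also have "norm \<dots> \<le> \<theta> * norm A + (\<eta> * (1 + \<theta>)) * norm (A $ j)"
    using assms by (intro norm_triangle_le) (simp add: norm_axis)
  also have "\<dots> \<le> \<theta> * norm A + (\<theta> * 2) * norm A"
    using assms by (intro add_left_mono mult_mono) (auto intro: Finite_Cartesian_Product.norm_nth_le)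
  finally show ?thesis by simp
qed

text \<open>The traces for \<eta> = \<theta> and \<eta> = 0 differ by \<theta> times one entry of
  \<open>M\<close>, and both are at most d in modulus. Each entry is thus at most 2d/\<theta>, and
  there are d * d of them.\<close>

lemma norm_le_of_spectral_radius_row_operations:
  fixes M :: "real ^ 'd ^ 'd"
  assumes "0 < \<theta>"
    and "\<And>i j \<eta>. \<eta> \<in> {0, \<theta>} \<Longrightarrow> matrix_spectral_radius (add_row_multiple \<eta> i j M) < 1"
  shows "norm M \<le> 2 * real CARD('d) ^ 3 / \<theta>"
proof -
  have entry: "\<bar>M $ j $ i\<bar> \<le> 2 * real CARD('d) / \<theta>" for i j
  proof -
    have "\<bar>trace M\<bar> \<le> CARD('d)" "\<bar>trace M + \<theta> * M $ j $ i\<bar> \<le> CARD('d)"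
      using abs_trace_le_of_spectral_radius_less_1[OF assms(2), of 0 i j]
        abs_trace_le_of_spectral_radius_less_1[OF assms(2), of \<theta> i j]
      by (simp_all add: trace_add_row_multiple)
    then have "\<bar>\<theta> * M $ j $ i\<bar> \<le> 2 * CARD('d)" by linarith
    then show ?thesis using assms(1) by (simp add: abs_mult field_simps)
  qed
  have "norm M \<le> (\<Sum>j\<in>UNIV. norm (M $ j))"
    by (simp add: norm_vec_def L2_set_le_sum)
  also have "\<dots> \<le> (\<Sum>j\<in>(UNIV :: 'd set). \<Sum>i\<in>(UNIV :: 'd set). \<bar>M $ j $ i\<bar>)"
    by (intro sum_mono norm_le_l1_cart)
  also have "\<dots> \<le> (\<Sum>j\<in>(UNIV :: 'd set). \<Sum>i\<in>(UNIV :: 'd set). 2 * real CARD('d) / \<theta>)"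
    by (intro sum_mono entry)
  finally show ?thesis by (simp add: power3_eq_cube mult_ac)
qed

section \<open>Orbits of circle rotations\<close>

lemma rot_funpow: "(rot x ^^ n) w = w * cis (2 * pi * (real n * x))"
  by (induction n) (simp_all add: rot_def cis_conv_exp algebra_simps flip: exp_add)

lemma rot_funpow_in_unit_circle: "w \<in> unit_circle \<Longrightarrow> (rot x ^^ n) w \<in> unit_circle"
  by (simp add: rot_funpow norm_mult)

lemma dist_cis_le: "dist (cis a) (cis b) \<le> \<bar>a - b\<bar>"
proof -
  have "cis a - cis b = cis b * (cis (a - b) - 1)" by (simp add: algebra_simps cis_mult)
  then have "dist (cis a) (cis b) = norm (cis (a - b) - 1)" by (simp add: dist_norm norm_mult)
  also have "\<dots> = 2 * \<bar>sin ((a - b) / 2)\<bar>" by (metis cis_conv_exp dist_exp_i_1)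
  also have "\<dots> \<le> \<bar>a - b\<bar>" using abs_sin_x_le_abs_x[of "(a - b) / 2"] by simp
  finally show ?thesis .
qed

lemma dist_rot_funpow_le:
  assumes "w \<in> unit_circle"
  shows "dist ((rot x ^^ n) w) ((rot y ^^ n) w) \<le> 2 * pi * real n * \<bar>x - y\<bar>"
proof -
  have "dist ((rot x ^^ n) w) ((rot y ^^ n) w)
      = dist (cis (2 * pi * (real n * x))) (cis (2 * pi * (real n * y)))"
    using assms by (simp add: rot_funpow dist_norm norm_mult flip: right_diff_distrib)
  also have "\<dots> \<le> \<bar>2 * pi * (real n * x) - 2 * pi * (real n * y)\<bar>" by (rule dist_cis_le)
  also have "\<dots> = 2 * pi * real n * \<bar>x - y\<bar>"
    by (simp add: abs_mult flip: right_diff_distrib)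
  finally show ?thesis .
qed

text \<open>If the points at times j and k agree, then jp/q and kp/q differ by an integer, so q
  divides (j - k)p and by coprimality j - k. Distinctness lets values be prescribed independently
  along the orbit.\<close>

lemma inj_on_rational_orbit:
  assumes "coprime p q" "0 < q" "w \<in> unit_circle"
  shows "inj_on (\<lambda>j. (rot (real p / real q) ^^ j) w) {..<q}"
proof (rule inj_onI)
  fix j k assume jk: "j \<in> {..<q}" "k \<in> {..<q}"
    and eq: "(rot (real p / real q) ^^ j) w = (rot (real p / real q) ^^ k) w"
  have "w \<noteq> 0" using assms(3) by auto
  then have "exp (\<i> * complex_of_real (2 * pi * (real j * (real p / real q))))
      = exp (\<i> * complex_of_real (2 * pi * (real k * (real p / real q))))"
    using eq by (simp add: rot_funpow cis_conv_exp)
  then obtain n :: int where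
    "\<i> * complex_of_real (2 * pi * (real j * (real p / real q)))
      = \<i> * complex_of_real (2 * pi * (real k * (real p / real q))) + (of_int (2 * n) * pi) * \<i>"
    unfolding exp_eq by blast
  then have "complex_of_real (2 * pi * (real j * (real p / real q)))
      = complex_of_real (2 * pi * (real k * (real p / real q)) + of_int (2 * n) * pi)"
    by (simp add: algebra_simps complex_eq_iff)
  then have "2 * pi * (real j * (real p / real q))
      = 2 * pi * (real k * (real p / real q)) + of_int (2 * n) * pi"
    using of_real_eq_iff by blast
  then have "2 * pi * (real j * (real p / real q)) = 2 * pi * (real k * (real p / real q) + of_int n)"
    by (simp add: algebra_simps)
  then have "real j * (real p / real q) = real k * (real p / real q) + of_int n"
    using pi_gt_zero by (metis mult_cancel_left pi_neq_zero mult_eq_0_iff zero_neq_numeral)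
  then have "real j * real p = real k * real p + of_int n * real q"
    using assms(2) by (simp add: field_simps)
  then have "real_of_int (int j * int p) = real_of_int (int k * int p + n * int q)" by simp
  then have "int j * int p = int k * int p + n * int q" by (simp only: of_int_eq_iff)
  then have "(int j - int k) * int p = n * int q" by (simp add: algebra_simps)
  then have "int q dvd (int j - int k) * int p" by simp
  then have "int q dvd int j - int k"
    using assms(1) by (simp add: coprime_dvd_mult_left_iff coprime_commute)
  then have "int j mod int q = int k mod int q" by (simp add: mod_eq_dvd_iff)
  then show "j = k" using jk by (simp flip: of_nat_mod)
qed

section \<open>Cocycle identity and comparison of norms\<close>

lemma cocycle_add: "cocycle F x (m + n) w = cocycle F x m ((rot x ^^ n) w) ** cocycle F x n w"
  by (induction m) (simp_all add: matrix_mul_assoc funpow_add)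

lemma bounded_bilinear_matrix_matrix_mult:
  "bounded_bilinear ((**) :: real ^ 'n ^ 'm \<Rightarrow> real ^ 'p ^ 'n \<Rightarrow> real ^ 'p ^ 'm)"
  unfolding bilinear_conv_bounded_bilinear[symmetric] bilinear_def
  by (intro conjI allI linearI)
    (simp_all add: vec_eq_iff matrix_matrix_mult_def algebra_simps sum.distrib sum_distrib_left)

lemma bounded_bilinear_matrix_vector_mult:
  "bounded_bilinear ((*v) :: real ^ 'n ^ 'm \<Rightarrow> real ^ 'n \<Rightarrow> real ^ 'm)"
  unfolding bilinear_conv_bounded_bilinear[symmetric] bilinear_def
  by (intro conjI allI linearI)
    (simp_all add: vec_eq_iff matrix_vector_mult_def algebra_simps sum.distrib sum_distrib_left)

lemma vector_norm_le_norm: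
  fixes \<nu> :: "real ^ 'd \<Rightarrow> real"
  assumes "is_vector_norm \<nu>"
  obtains K where "0 < K" "\<And>v. \<nu> v \<le> K * norm v"
proof -
  have nonneg: "0 \<le> \<nu> v" and zero: "\<nu> 0 = 0" and scale: "\<nu> (c *\<^sub>R v) = \<bar>c\<bar> * \<nu> v"
    and add: "\<nu> (u + v) \<le> \<nu> u + \<nu> v" for c u v
    using assms unfolding is_vector_norm_def by blast+
  have sum: "\<nu> (\<Sum>i\<in>I. f i) \<le> (\<Sum>i\<in>I. \<nu> (f i))" for I and f :: "'d \<Rightarrow> real ^ 'd"
    by (induction I rule: infinite_finite_induct) (auto simp: zero intro: order_trans[OF add])
  define K where "K = (\<Sum>i\<in>UNIV. \<nu> (axis i 1)) + 1"
  have "\<nu> v \<le> K * norm v" for v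
  proof -
    have "\<nu> v = \<nu> (\<Sum>i\<in>UNIV. v $ i *\<^sub>R axis i 1)"
      using basis_expansion[of v] by (simp add: scalar_mult_eq_scaleR)
    also have "\<dots> \<le> (\<Sum>i\<in>UNIV. \<bar>v $ i\<bar> * \<nu> (axis i 1))"
      using sum[of "\<lambda>i. v $ i *\<^sub>R axis i 1" UNIV] by (simp add: scale)
    also have "\<dots> \<le> (\<Sum>i\<in>UNIV. norm v * \<nu> (axis i 1))"
      by (intro sum_mono mult_right_mono component_le_norm_cart nonneg)
    also have "\<dots> \<le> K * norm v"
      by (simp add: K_def algebra_simps sum_distrib_left)
    finally show ?thesis .
  qed
  moreover have "0 < K" unfolding K_def using nonneg by (simp add: add_nonneg_pos sum_nonneg)
  ultimately show ?thesis using that by blast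
qed

text \<open>By the reverse triangle inequality \<nu> is Lipschitz, so it attains a minimum on the
  compact Euclidean unit sphere; this minimum is positive and serves as \<open>m\<close>.\<close>

lemma norm_le_vector_norm:
  fixes \<nu> :: "real ^ 'd \<Rightarrow> real"
  assumes "is_vector_norm \<nu>"
  obtains m where "0 < m" "\<And>v. m * norm v \<le> \<nu> v"
proof -
  have nonneg: "0 \<le> \<nu> v" and zero: "\<nu> v = 0 \<longleftrightarrow> v = 0"
    and scale: "\<nu> (c *\<^sub>R v) = \<bar>c\<bar> * \<nu> v" and add: "\<nu> (u + v) \<le> \<nu> u + \<nu> v" for c u v
    using assms unfolding is_vector_norm_def by blast+
  obtain K where K: "0 < K" "\<And>v. \<nu> v \<le> K * norm v"
    using vector_norm_le_norm[OF assms] by blast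
  have "\<bar>\<nu> u - \<nu> v\<bar> \<le> K * norm (u - v)" for u v
    using add[of "u - v" v] add[of "v - u" u] K(2)[of "u - v"] K(2)[of "v - u"]
    by (simp add: norm_minus_commute)
  then have "K-lipschitz_on UNIV \<nu>"
    using K(1) by (intro lipschitz_onI) (simp_all add: dist_norm)
  then have "continuous_on (sphere 0 1) \<nu>"
    by (meson continuous_on_subset lipschitz_on_continuous_on subset_UNIV)
  moreover have "(sphere 0 1 :: (real ^ 'd) set) \<noteq> {}" by simp
  ultimately obtain x where x: "norm x = 1" "\<And>y. norm y = 1 \<Longrightarrow> \<nu> x \<le> \<nu> y"
    using continuous_attains_inf[of "sphere 0 1" \<nu>] by (auto simp: compact_sphere)
  have "\<nu> x * norm v \<le> \<nu> v" for v
  proof (cases "v = 0")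
    case False
    have "\<nu> x \<le> \<nu> ((1 / norm v) *\<^sub>R v)" using False by (intro x(2)) simp
    also have "\<dots> = \<nu> v / norm v" by (simp add: scale)
    finally show ?thesis using False by (simp add: field_simps)
  qed (simp add: nonneg)
  moreover have "0 < \<nu> x"
  proof -
    have "x \<noteq> 0" using x(1) by auto
    then show ?thesis using nonneg[of x] zero[of x] by linarith
  qed
  ultimately show ?thesis using that by blast
qed

text \<open>The estimates are carried out in the Euclidean norm on matrices. This bound places small
  Euclidean perturbations inside the \<epsilon>-ball of the hypothesis and carries the final decay
  over to the induced norm.\<close>

lemma induced_norm_le_norm:
  fixes \<nu> :: "real ^ 'd \<Rightarrow> real"
  assumes "is_vector_norm \<nu>"
  obtains K where "0 < K" "\<And>A. induced_norm \<nu> A \<le> K * norm A"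
proof -
  obtain k where k: "0 < k" "\<And>v. \<nu> v \<le> k * norm v"
    using vector_norm_le_norm[OF assms] by blast
  obtain m where m: "0 < m" "\<And>v. m * norm v \<le> \<nu> v"
    using norm_le_vector_norm[OF assms] by blast
  obtain L where L: "0 < L" "\<And>(A :: real ^ 'd ^ 'd) (v :: real ^ 'd). norm (A *v v) \<le> norm A * norm v * L"
    using bounded_bilinear.pos_bounded[OF bounded_bilinear_matrix_vector_mult] by blast
  have "induced_norm \<nu> A \<le> (k * L / m) * norm A" for A
    unfolding induced_norm_def
  proof (rule cSUP_least)
    \<comment> \<open>A supremum bound needs a nonempty index set; a rescaled basis vector, in an
      arbitrary coordinate, has \<nu>-norm 1.\<close>
    define e :: "real ^ 'd" where "e = axis undefined 1"
    have e: "norm e = 1" by (simp add: e_def)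
    then have pos: "0 < \<nu> e" using m(1) m(2)[of e] by simp
    have "\<nu> ((1 / \<nu> e) *\<^sub>R e) = \<bar>1 / \<nu> e\<bar> * \<nu> e"
      using assms unfolding is_vector_norm_def by blast
    then have "\<nu> ((1 / \<nu> e) *\<^sub>R e) = 1" using pos by simp
    then show "{v. \<nu> v = 1} \<noteq> {}" by blast
  next
    fix v assume "v \<in> {v. \<nu> v = 1}"
    then have v: "norm v \<le> 1 / m" using m(1) m(2)[of v] by (simp add: field_simps)
    have "\<nu> (A *v v) \<le> k * norm (A *v v)" by (rule k(2))
    also have "\<dots> \<le> k * (norm A * norm v * L)" using k(1) by (intro mult_left_mono L(2)) auto
    also have "\<dots> \<le> k * (norm A * (1 / m) * L)"
      using k(1) L(1) v by (intro mult_left_mono mult_right_mono) auto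
    finally show "\<nu> (A *v v) \<le> (k * L / m) * norm A" by (simp add: field_simps)
  qed
  then show ?thesis using that[of "k * L / m"] k(1) L(1) m(1) by simp
qed

lemma map_norm_le:
  assumes "\<And>A. induced_norm \<nu> A \<le> K * norm A" "0 \<le> K"
    and "\<And>w. w \<in> unit_circle \<Longrightarrow> norm (F w) \<le> r"
  shows "map_norm \<nu> F \<le> K * r"
  unfolding map_norm_def
proof (rule cSUP_least)
  fix w :: complex assume "w \<in> unit_circle"
  then have "K * norm (F w) \<le> K * r" using assms(2,3) by (intro mult_left_mono)
  then show "induced_norm \<nu> (F w) \<le> K * r" using assms(1)[of "F w"] by linarith
qed simp

section \<open>Small perturbations of continuous matrix maps\<close>

text \<open>The correction needed at the prescribed points is continuous on a finite, hence closed,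
  set. Tietze extends it to \<open>X\<close> with the same bound, and the extension is added to
  \<open>S\<close>.\<close>

lemma continuous_perturbation_with_prescribed_values:
  fixes S :: "'a::{metric_space,second_countable_topology} \<Rightarrow> 'b::euclidean_space"
  assumes "continuous_on X S" "finite J" "inj_on z J" "z ` J \<subseteq> X" "0 \<le> r"
    and "\<And>j. j \<in> J \<Longrightarrow> norm (T j - S (z j)) \<le> r"
  obtains B where "continuous_on X B" "\<And>w. w \<in> X \<Longrightarrow> norm (B w - S w) \<le> r"
    and "\<And>j. j \<in> J \<Longrightarrow> B (z j) = T j"
proof -
  define D where "D v = T (inv_into J z v) - S v" for v
  have "continuous_on (z ` J) D" using assms(2) by (simp add: continuous_on_finite)
  moreover have "closedin (top_of_set X) (z ` J)"
    using assms(2,4) by (intro closed_subset finite_imp_closed) auto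
  moreover have "norm (D v) \<le> r" if "v \<in> z ` J" for v
    using that assms(3,6) by (auto simp: D_def)
  ultimately obtain G where G: "continuous_on X G" "\<And>v. v \<in> z ` J \<Longrightarrow> G v = D v"
    "\<And>v. v \<in> X \<Longrightarrow> norm (G v) \<le> r"
    using Tietze[of "z ` J" D X r] assms(5) by blast
  show ?thesis
  proof
    show "continuous_on X (\<lambda>w. S w + G w)" using assms(1) G(1) by (rule continuous_on_add)
    show "norm (S w + G w - S w) \<le> r" if "w \<in> X" for w using G(3)[OF that] by simp
    show "S (z j) + G (z j) = T j" if "j \<in> J" for j
      using that G(2) assms(3) by (simp add: D_def)
  qed
qed

lemma continuous_on_det:
  fixes F :: "'a::topological_space \<Rightarrow> real ^ 'n ^ 'n"
  shows "continuous_on X F \<Longrightarrow> continuous_on X (\<lambda>x. det (F x))"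
  unfolding det_def by (intro continuous_intros)

lemma open_invertible: "open {A :: real ^ 'n ^ 'n. invertible A}"
proof -
  have "{A :: real ^ 'n ^ 'n. invertible A} = {A. det A \<noteq> 0}" by (simp add: invertible_det_nz)
  then show ?thesis
    using open_Collect_neq[OF continuous_on_det[OF continuous_on_id] continuous_on_const] by simp
qed

text \<open>The image of the circle is a compact subset of the open set of invertible matrices, so
  one radius works at all of its points.\<close>

lemma continuous_GL_map_stable:
  assumes "continuous_GL_map S"
  obtains r where "0 < r"
    "\<And>B. continuous_on unit_circle B \<Longrightarrow> (\<And>w. w \<in> unit_circle \<Longrightarrow> norm (B w - S w) < r)
      \<Longrightarrow> continuous_GL_map B"
proof -
  have "compact (S ` unit_circle)" "S ` unit_circle \<subseteq> {A. invertible A}"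
    using assms by (auto simp: continuous_GL_map_def intro: compact_continuous_image)
  then obtain r where r: "r > 0" "(\<Union>A\<in>S ` unit_circle. ball A r) \<subseteq> {A. invertible A}"
    using compact_subset_open_imp_ball_epsilon_subset[OF _ open_invertible] by blast
  show ?thesis
  proof
    show "continuous_GL_map B" if "continuous_on unit_circle B"
      and "\<And>w. w \<in> unit_circle \<Longrightarrow> norm (B w - S w) < r" for B
      unfolding continuous_GL_map_def
    proof (intro conjI ballI)
      fix w :: complex assume w: "w \<in> unit_circle"
      then have "B w \<in> ball (S w) r" using that(2)[OF w] by (simp add: dist_norm norm_minus_commute)
      then show "invertible (B w)" using w r(2) by blast
    qed (rule that(1))
  qed (rule r(1))
qed

section \<open>Realizing modified cocycles over periodic orbits\<close>

lemma cocycle_eq_of_scaled_orbit: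
  assumes "\<And>k. k < n \<Longrightarrow> B ((rot x ^^ k) w) = c *\<^sub>R S ((rot y ^^ k) w)"
  shows "cocycle B x n w = c ^ n *\<^sub>R cocycle S y n w"
  using assms
  by (induction n)
    (simp_all add: bounded_bilinear.scaleR_left[OF bounded_bilinear_matrix_matrix_mult]
      bounded_bilinear.scaleR_right[OF bounded_bilinear_matrix_matrix_mult])

text \<open>Up to time \<open>q\<close> the orbits of \<open>w\<close> under the rotations by \<open>\<omega>\<close> and \<open>p / q\<close> stay within
  \<open>2 \<pi> / q\<close> of each other, and the points of the latter are distinct. So a small perturbation of
  \<open>S\<close> can reproduce along the periodic orbit the values of \<open>S\<close> along the irrational one.\<close>

lemma realize_as_periodic_cocycle:
  fixes \<nu> :: "real ^ 'd \<Rightarrow> real"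
  assumes "is_vector_norm \<nu>" "continuous_GL_map S" "0 < \<epsilon>"
  obtains \<theta> Q where "0 < \<theta>"
    and "\<And>p q w i j \<eta>. \<lbrakk>Q \<le> real q; 0 < q; coprime p q; \<bar>\<omega> - real p / real q\<bar> < 1 / (real q)\<^sup>2;
      w \<in> unit_circle; \<eta> \<in> {0, \<theta>}\<rbrakk>
      \<Longrightarrow> \<exists>B. continuous_GL_map B \<and> map_norm \<nu> (\<lambda>w. S w - B w) < \<epsilon> \<and>
        cocycle B (real p / real q) q w
          = add_row_multiple \<eta> i j ((1 + \<theta>) ^ q *\<^sub>R cocycle S \<omega> q w)"
proof -
  have cont: "continuous_on unit_circle S" using assms(2) by (simp add: continuous_GL_map_def)
  obtain K where K: "0 < K" "\<And>A. induced_norm \<nu> A \<le> K * norm A"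
    using induced_norm_le_norm[OF assms(1)] by blast
  obtain \<rho> where \<rho>: "0 < \<rho>" "\<And>B. continuous_on unit_circle B
      \<Longrightarrow> (\<And>w. w \<in> unit_circle \<Longrightarrow> norm (B w - S w) < \<rho>) \<Longrightarrow> continuous_GL_map B"
    using continuous_GL_map_stable[OF assms(2)] by blast
  \<comment> \<open>The first bound keeps the perturbed map invertible, the second keeps it
    \<epsilon>-close in \<open>map_norm\<close>; the halves make both inequalities strict.\<close>
  define r where "r = min (\<rho> / 2) (\<epsilon> / (2 * K))"
  have "0 < r" "r < \<rho>" using \<rho>(1) K(1) assms(3) by (auto simp: r_def)
  have "K * r \<le> K * (\<epsilon> / (2 * K))" using K(1) by (intro mult_left_mono) (auto simp: r_def)
  also have "\<dots> < \<epsilon>" using K(1) assms(3) by simp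
  finally have Kr: "K * r < \<epsilon>" .
  have "compact (S ` unit_circle)" using cont by (intro compact_continuous_image) auto
  then obtain C where C: "0 < C" "\<And>w. w \<in> unit_circle \<Longrightarrow> norm (S w) \<le> C"
    using compact_imp_bounded bounded_pos by (metis imageI)
  have "uniformly_continuous_on unit_circle S"
    using cont by (intro compact_uniformly_continuous) auto
  then obtain \<delta> where \<delta>: "0 < \<delta>"
    "\<And>v w. v \<in> unit_circle \<Longrightarrow> w \<in> unit_circle \<Longrightarrow> dist v w < \<delta> \<Longrightarrow> dist (S v) (S w) < r / 2"
    unfolding uniformly_continuous_on_def using \<open>0 < r\<close> half_gt_zero by metis
  \<comment> \<open>Half of the budget \<open>r\<close> pays for scaling and row operation, which
    cost at most 3\<theta>C; the other half pays for the distance between the two orbits. The choice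
    is independent of q and w.\<close>
  define \<theta> where "\<theta> = min 1 (r / (6 * C))"
  have \<theta>: "0 < \<theta>" "\<theta> \<le> 1" "3 * \<theta> * C \<le> r / 2"
  proof -
    have "\<theta> \<le> r / (6 * C)" by (simp add: \<theta>_def)
    then show "3 * \<theta> * C \<le> r / 2" using C(1) by (simp add: field_simps)
  qed (use \<open>0 < r\<close> C(1) in \<open>auto simp: \<theta>_def\<close>)
  \<comment> \<open>The summand 1 turns q \<ge> Q into the strict inequality 2 pi/q <
    \<delta>.\<close>
  define Q where "Q = 2 * pi / \<delta> + 1"
  show ?thesis
  proof (rule that[of \<theta> Q, OF \<theta>(1)])
    fix p q :: nat and w :: complex and i j :: 'd and \<eta> :: real
    assume q: "Q \<le> real q" "0 < q" and "coprime p q" and approx: "\<bar>\<omega> - real p / real q\<bar> < 1 / (real q)\<^sup>2"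
      and w: "w \<in> unit_circle" and \<eta>: "\<eta> \<in> {0, \<theta>}"
    define x where "x = real p / real q"
    \<comment> \<open>Only the factor at time q - 1 carries the row operation. It is the leftmost
      one, so the operation acts on the whole period product.\<close>
    define \<eta>' where "\<eta>' k = (if Suc k = q then \<eta> else 0)" for k
    define T where "T k = add_row_multiple (\<eta>' k) i j ((1 + \<theta>) *\<^sub>R S ((rot \<omega> ^^ k) w))" for k
    have "norm (T k - S ((rot x ^^ k) w)) \<le> r" if "k < q" for k
    proof -
      have "dist ((rot \<omega> ^^ k) w) ((rot x ^^ k) w) \<le> 2 * pi * real k * \<bar>\<omega> - x\<bar>"
        by (rule dist_rot_funpow_le[OF w])
      also have "\<dots> \<le> 2 * pi * real q * (1 / (real q)\<^sup>2)"
        using approx that by (intro mult_mono) (auto simp: x_def)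
      also have "\<dots> = 2 * pi / real q" using q(2) by (simp add: power2_eq_square)
      also have "\<dots> < \<delta>"
      proof -
        have "2 * pi / \<delta> < real q" using q(1) by (simp add: Q_def)
        then show ?thesis using \<delta>(1) q(2) by (simp add: field_simps)
      qed
      finally have "norm (S ((rot \<omega> ^^ k) w) - S ((rot x ^^ k) w)) < r / 2"
        unfolding dist_norm[symmetric] by (intro \<delta>(2) rot_funpow_in_unit_circle w)
      moreover have "norm (T k - S ((rot \<omega> ^^ k) w)) \<le> r / 2"
      proof -
        have "norm (T k - S ((rot \<omega> ^^ k) w)) \<le> 3 * \<theta> * norm (S ((rot \<omega> ^^ k) w))"
          unfolding T_def using \<theta> \<eta> by (intro norm_add_row_multiple_diff_le) (auto simp: \<eta>'_def)
        also have "\<dots> \<le> 3 * \<theta> * C"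
          using \<theta>(1) by (intro mult_left_mono C(2) rot_funpow_in_unit_circle w) auto
        finally show ?thesis using \<theta>(3) by linarith
      qed
      ultimately show ?thesis
        using norm_triangle_ineq[of "T k - S ((rot \<omega> ^^ k) w)"
            "S ((rot \<omega> ^^ k) w) - S ((rot x ^^ k) w)"] by simp
    qed
    moreover have "inj_on (\<lambda>k. (rot x ^^ k) w) {..<q}"
      unfolding x_def by (rule inj_on_rational_orbit) fact+
    moreover have "(\<lambda>k. (rot x ^^ k) w) ` {..<q} \<subseteq> unit_circle"
      using rot_funpow_in_unit_circle[OF w] by blast
    ultimately obtain B where B: "continuous_on unit_circle B"
      "\<And>w. w \<in> unit_circle \<Longrightarrow> norm (B w - S w) \<le> r"
      "\<And>k. k \<in> {..<q} \<Longrightarrow> B ((rot x ^^ k) w) = T k"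
      using continuous_perturbation_with_prescribed_values
          [OF cont finite_lessThan, of "\<lambda>k. (rot x ^^ k) w" q r T] \<open>0 < r\<close>
      by (metis lessThan_iff less_imp_le)
    have "continuous_GL_map B" using \<rho>(2)[OF B(1)] B(2) \<open>r < \<rho>\<close> by (meson le_less_trans)
    moreover have "map_norm \<nu> (\<lambda>w. S w - B w) < \<epsilon>"
    proof -
      have "map_norm \<nu> (\<lambda>w. S w - B w) \<le> K * r"
        using K B(2) by (intro map_norm_le) (auto simp: norm_minus_commute)
      then show ?thesis using Kr by linarith
    qed
    moreover have "cocycle B x q w = add_row_multiple \<eta> i j ((1 + \<theta>) ^ q *\<^sub>R cocycle S \<omega> q w)"
    proof -
      obtain m where m: "q = Suc m" using q(2) gr0_implies_Suc by blast
      have "cocycle B x m w = (1 + \<theta>) ^ m *\<^sub>R cocycle S \<omega> m w"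
        by (rule cocycle_eq_of_scaled_orbit) (simp add: B(3) m T_def \<eta>'_def add_row_multiple_def)
      then show ?thesis
        by (simp add: m B(3) T_def \<eta>'_def add_row_multiple_mult add_row_multiple_scaleR mult.commute
            bounded_bilinear.scaleR_left[OF bounded_bilinear_matrix_matrix_mult]
            bounded_bilinear.scaleR_right[OF bounded_bilinear_matrix_matrix_mult])
    qed
    ultimately show "\<exists>B. continuous_GL_map B \<and> map_norm \<nu> (\<lambda>w. S w - B w) < \<epsilon> \<and>
        cocycle B (real p / real q) q w
          = add_row_multiple \<eta> i j ((1 + \<theta>) ^ q *\<^sub>R cocycle S \<omega> q w)"
      unfolding x_def by blast
  qed
qed

section \<open>From contraction at one time to exponential decay\<close>

text \<open>Each block of q steps halves the norm, and the fewer than q remaining steps cost a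
  bounded factor. The constant \<open>L\<close> corrects for submultiplicativity holding only up to
  a factor.\<close>

lemma uniformly_exponentially_stable_of_contracting_time:
  fixes S :: "complex \<Rightarrow> real ^ 'd ^ 'd"
  assumes "is_vector_norm \<nu>" "continuous_on unit_circle S" "0 < q" "0 < L"
    and L: "\<And>(A :: real ^ 'd ^ 'd) (C :: real ^ 'd ^ 'd). norm (A ** C) \<le> norm A * norm C * L"
    and contr: "\<And>w. w \<in> unit_circle \<Longrightarrow> norm (cocycle S \<omega> q w) * L \<le> 1 / 2"
  shows "uniformly_exponentially_stable \<nu> S \<omega>"
proof -
  obtain K where K: "0 < K" "\<And>A. induced_norm \<nu> A \<le> K * norm A"
    using induced_norm_le_norm[OF assms(1)] by blast
  have "compact (S ` unit_circle)" using assms(2) by (intro compact_continuous_image) auto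
  then obtain C where C: "0 < C" "\<And>w. w \<in> unit_circle \<Longrightarrow> norm (S w) \<le> C"
    using compact_imp_bounded bounded_pos by (metis imageI)
  define P where "P = max 1 (C * L)"
  have P: "1 \<le> P" "C * L \<le> P" by (simp_all add: P_def)
  define M where "M = norm (mat 1 :: real ^ 'd ^ 'd) + 1"
  have M: "0 < M" by (simp add: M_def add_nonneg_pos)
  have crude: "norm (cocycle S \<omega> n w) \<le> M * P ^ n" if "w \<in> unit_circle" for n w
  proof (induction n)
    case (Suc n)
    have "norm (cocycle S \<omega> (Suc n) w) \<le> norm (S ((rot \<omega> ^^ n) w)) * norm (cocycle S \<omega> n w) * L"
      unfolding cocycle.simps by (rule L)
    also have "\<dots> \<le> C * (M * P ^ n) * L"
      using C(1) \<open>0 < L\<close> Suc.IH C(2)[OF rot_funpow_in_unit_circle[OF that]]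
      by (intro mult_right_mono mult_mono) auto
    also have "\<dots> = C * L * (M * P ^ n)" by (simp add: mult_ac)
    also have "\<dots> \<le> P * (M * P ^ n)" using P M by (intro mult_right_mono) auto
    finally show ?case by (simp add: mult_ac)
  qed (simp add: M_def)
  define \<gamma> where "\<gamma> = root q (1 / 2)"
  have \<gamma>: "0 < \<gamma>" "\<gamma> < 1" "\<gamma> ^ q = 1 / 2" using \<open>0 < q\<close> by (simp_all add: \<gamma>_def)
  \<comment> \<open>For n < q the crude bound is at most M P^q, while \<gamma>^n \<ge> \<gamma>^q =
    1/2; the factor 2 compensates for this.\<close>
  define D where "D = 2 * M * P ^ q"
  have "0 < D" using M P by (simp add: D_def)
  have bound: "norm (cocycle S \<omega> n w) \<le> D * \<gamma> ^ n" if "w \<in> unit_circle" for n w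
    using that
  proof (induction n arbitrary: w rule: less_induct)
    case (less n)
    show ?case
    proof (cases "n < q")
      case True
      have "norm (cocycle S \<omega> n w) \<le> M * P ^ n" by (rule crude[OF less.prems])
      also have "\<dots> \<le> M * P ^ q" using M P True by (intro mult_left_mono power_increasing) auto
      also have "\<dots> = D * \<gamma> ^ q" by (simp add: D_def \<gamma>(3))
      also have "\<dots> \<le> D * \<gamma> ^ n"
        using \<gamma> True \<open>0 < D\<close> by (intro mult_left_mono power_decreasing) auto
      finally show ?thesis .
    next
      case False
      \<comment> \<open>The first q steps are split off as the right factor; the other
        \<open>k\<close> steps start at the rotated point, which is why the induction varies
        \<open>w\<close>.\<close>
      then obtain k where k: "n = k + q" by (metis add.commute le_Suc_ex not_less)
      have "norm (cocycle S \<omega> n w)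
          \<le> norm (cocycle S \<omega> k ((rot \<omega> ^^ q) w)) * norm (cocycle S \<omega> q w) * L"
        unfolding k cocycle_add by (rule L)
      also have "\<dots> \<le> D * \<gamma> ^ k * (1 / 2)"
        unfolding mult.assoc[of _ "norm (cocycle S \<omega> q w)"]
        using less.IH[of k "(rot \<omega> ^^ q) w"] rot_funpow_in_unit_circle[OF less.prems]
          contr[OF less.prems] k \<open>0 < q\<close> \<open>0 < D\<close> \<gamma>(1) \<open>0 < L\<close>
        by (intro mult_mono) auto
      also have "\<dots> = D * \<gamma> ^ n" by (simp add: k power_add \<gamma>(3))
      finally show ?thesis .
    qed
  qed
  have "induced_norm \<nu> (cocycle S \<omega> n w) \<le> (K * D) * \<gamma> ^ n" if "w \<in> unit_circle" for n w
  proof -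
    have "induced_norm \<nu> (cocycle S \<omega> n w) \<le> K * norm (cocycle S \<omega> n w)" by (rule K(2))
    also have "\<dots> \<le> K * (D * \<gamma> ^ n)" using K(1) bound[OF that] by (intro mult_left_mono) auto
    finally show ?thesis by simp
  qed
  moreover have "0 < K * D" using K(1) \<open>0 < D\<close> by simp
  ultimately show ?thesis
    unfolding uniformly_exponentially_stable_def using \<gamma>(1,2) by blast
qed

theorem theorem1p11:
  fixes \<nu> :: "real ^ 'd \<Rightarrow> real"
    and S :: "complex \<Rightarrow> real ^ 'd ^ 'd"
    and \<omega> :: real
  assumes "is_vector_norm \<nu>"
    and "0 < \<omega>" and "\<omega> < 1" and "\<omega> \<notin> \<rat>"
    and "continuous_GL_map S"
    and "robustly_periodically_stable \<nu> S \<omega>"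
  shows "uniformly_exponentially_stable \<nu> S \<omega>"
proof -
  obtain \<epsilon> :: real and p q :: "nat \<Rightarrow> nat" and N where "0 < \<epsilon>"
    and pq: "\<And>n. 0 < q n" "\<And>n. coprime (p n) (q n)"
    and lim: "filterlim q at_top sequentially"
    and approx: "\<And>n. \<bar>\<omega> - real (p n) / real (q n)\<bar> < 1 / (real (q n))\<^sup>2"
    and stable: "\<And>B n w. \<lbrakk>continuous_GL_map B; map_norm \<nu> (\<lambda>w. S w - B w) < \<epsilon>; N \<le> n; w \<in> unit_circle\<rbrakk>
      \<Longrightarrow> matrix_spectral_radius (cocycle B (real (p n) / real (q n)) (q n) w) < 1"
    using assms(6) unfolding robustly_periodically_stable_def by blast
  obtain \<theta> Q where \<theta>: "0 < \<theta>"
    and realize: "\<And>p q w i j \<eta>. \<lbrakk>Q \<le> real q; 0 < q; coprime p q;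
      \<bar>\<omega> - real p / real q\<bar> < 1 / (real q)\<^sup>2; w \<in> unit_circle; \<eta> \<in> {0, \<theta>}\<rbrakk>
      \<Longrightarrow> \<exists>B. continuous_GL_map B \<and> map_norm \<nu> (\<lambda>w. S w - B w) < \<epsilon> \<and>
        cocycle B (real p / real q) q w
          = add_row_multiple \<eta> i j ((1 + \<theta>) ^ q *\<^sub>R cocycle S \<omega> q w)"
    using realize_as_periodic_cocycle[OF assms(1,5) \<open>0 < \<epsilon>\<close>] by blast
  obtain L where L: "0 < L" "\<And>(A :: real ^ 'd ^ 'd) (C :: real ^ 'd ^ 'd). norm (A ** C) \<le> norm A * norm C * L"
    using bounded_bilinear.pos_bounded[OF bounded_bilinear_matrix_matrix_mult] by blast
  \<comment> \<open>This bounds the rescaled cocycle independently of q and w, so the growing factor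
    (1 + \<theta>)^q forces contraction once it reaches 2Lc.\<close>
  define c where "c = 2 * real CARD('d) ^ 3 / \<theta>"
  obtain m where m: "2 * L * c < (1 + \<theta>) ^ m" using real_arch_pow[of "1 + \<theta>" "2 * L * c"] \<theta> by auto
  \<comment> \<open>One index must meet three demands: \<open>N\<close> for the stability
    hypothesis, \<open>Q\<close> for the realization of perturbations, and \<open>m\<close> for the
    growth of (1 + \<theta>)^q.\<close>
  have "eventually (\<lambda>n. max m (nat \<lceil>Q\<rceil>) \<le> q n \<and> N \<le> n) sequentially"
    using lim[unfolded filterlim_at_top] eventually_ge_at_top[of N] by (intro eventually_conj) blast+
  then obtain n where "max m (nat \<lceil>Q\<rceil>) \<le> q n" "N \<le> n"
    using eventually_happens'[OF sequentially_bot] by blast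
  moreover have "(1 + \<theta>) ^ m \<le> (1 + \<theta>) ^ q n"
    using calculation(1) \<theta> by (intro power_increasing) auto
  ultimately have n: "N \<le> n" "Q \<le> real (q n)" "2 * L * c \<le> (1 + \<theta>) ^ q n"
    using m by (auto simp: nat_le_iff ceiling_le_iff)
  have "norm (cocycle S \<omega> (q n) w) * L \<le> 1 / 2" if w: "w \<in> unit_circle" for w
  proof -
    have pos: "0 < (1 + \<theta>) ^ q n" using \<theta> by simp
    have "norm ((1 + \<theta>) ^ q n *\<^sub>R cocycle S \<omega> (q n) w) \<le> c"
      unfolding c_def
    proof (rule norm_le_of_spectral_radius_row_operations[OF \<theta>])
      fix i j :: 'd and \<eta> assume "\<eta> \<in> {0, \<theta>}"
      then obtain B where "continuous_GL_map B" "map_norm \<nu> (\<lambda>w. S w - B w) < \<epsilon>"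
        "cocycle B (real (p n) / real (q n)) (q n) w
          = add_row_multiple \<eta> i j ((1 + \<theta>) ^ q n *\<^sub>R cocycle S \<omega> (q n) w)"
        using realize[OF n(2) pq approx w] by blast
      then show "matrix_spectral_radius
          (add_row_multiple \<eta> i j ((1 + \<theta>) ^ q n *\<^sub>R cocycle S \<omega> (q n) w)) < 1"
        using stable[of B n w] n(1) w by simp
    qed
    then have "(1 + \<theta>) ^ q n * norm (cocycle S \<omega> (q n) w) \<le> c" using pos by simp
    then have "(1 + \<theta>) ^ q n * norm (cocycle S \<omega> (q n) w) * L \<le> c * L"
      using L(1) by (intro mult_right_mono) auto
    also have "\<dots> \<le> (1 + \<theta>) ^ q n * (1 / 2)" using n(3) by (simp add: mult_ac)
    finally have "(1 + \<theta>) ^ q n * (norm (cocycle S \<omega> (q n) w) * L) \<le> (1 + \<theta>) ^ q n * (1 / 2)"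
      by (simp only: mult.assoc)
    then show ?thesis using pos by (simp only: mult_le_cancel_left_pos)
  qed
  then show ?thesis
    using assms(1,5) pq(1) L
    by (intro uniformly_exponentially_stable_of_contracting_time[of \<nu> S "q n" L])
      (auto simp: continuous_GL_map_def)
qed

end
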